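(* Let $F$ be a field, let $A$ be a finite dimensional associative algebra over $F$ with basis $(\overline{e}_i)$ and structural constants $C_{ij}^k\in F$, let $a_{s\cdot 0}, a_{s\cdot 1}\in A$ ($s$ ranging over a finite index set), and let $b\in A$. Consider the equation $$\sum_s a_{s\cdot 0}\,x\,a_{s\cdot 1}=b$$ in the unknown $x\in A$. Write $a_{s\cdot 0}=\sum_i a_{s\cdot 0}{}^{i}\,\overline{e}_i$, $a_{s\cdot 1}=\sum_i a_{s\cdot 1}{}^{i}\,\overline{e}_i$, and set $$a^{ij}=\sum_s a_{s\cdot 0}{}^{i}\,a_{s\cdot 1}{}^{j},\qquad a_i^j=\sum_{k,r,p} a^{kr}\,C_{ki}^p\,C_{pr}^j .$$ (1) If $\det\|a_i^j\|\neq 0$, then the equation has exactly one solution $x\in A$. (2) If $\det\|a_i^j\|=0$, then the equation has a solution if and only if $b$ is an $F$-linear combination of the vectors $\sum_j a_i^j\,\overline{e}_j$; in this case the equation has infinitely many solutions, and otherwise it has no solution.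
   Context: The structural constants $C_{ij}^k\in F$ of $A$ relative to the basis $(\overline{e}_i)$ are defined by $\overline{e}_i\overline{e}_j=\sum_k C_{ij}^k\,\overline{e}_k$. $\|a_i^j\|$ denotes the square matrix with entries $a_i^j$, where $i$ and $j$ run over the index set of the basis.
   Formalization: The claim of infinitely many solutions in (2) is made only for infinite F; over a finite field A is finite, so it fails (e.g. F = A = GF(2), empty sum, b = 0 has exactly two solutions). All other claims hold for every field. *)

theory Defs
  imports Main "Jordan_Normal_Form.Determinant"
begin

text \<open>Not assumed unital or commutative. The algebra is the whole type \<^typ>\<open>'a\<close>; the base field
  is the type \<^typ>\<open>'f\<close>. The zero algebra is included (the class \<^class>\<open>ring\<close> has no unit).\<close>

locale assoc_algebra = Vector_Spaces.vector_space scale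
  for scale :: "'f::field \<Rightarrow> 'a::ring \<Rightarrow> 'a" (infixr \<open>*s\<close> 75) +
  assumes scale_mult_left: "(c *s x) * y = c *s (x * y)"
    and scale_mult_right: "x * (c *s y) = c *s (x * y)"
begin

definition is_basis :: "nat \<Rightarrow> (nat \<Rightarrow> 'a) \<Rightarrow> bool" where
  "is_basis n e \<longleftrightarrow>
     inj_on e {..<n} \<and> independent (e ` {..<n}) \<and> span (e ` {..<n}) = UNIV"

text \<open>\<open>C i j k\<close> stands for $C_{ij}^k$.\<close>

definition structural_constants ::
    "nat \<Rightarrow> (nat \<Rightarrow> 'a) \<Rightarrow> (nat \<Rightarrow> nat \<Rightarrow> nat \<Rightarrow> 'f) \<Rightarrow> bool" where
  "structural_constants n e C \<longleftrightarrow>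
     (\<forall>i<n. \<forall>j<n. e i * e j = (\<Sum>k<n. C i j k *s e k))"

definition coordinates :: "nat \<Rightarrow> (nat \<Rightarrow> 'a) \<Rightarrow> 'a \<Rightarrow> (nat \<Rightarrow> 'f) \<Rightarrow> bool" where
  "coordinates n e x c \<longleftrightarrow> x = (\<Sum>i<n. c i *s e i)"

end

text \<open>$a^{ij}$, from the coordinates \<open>\<alpha> s i\<close> of $a_{s\cdot 0}$ and \<open>\<beta> s j\<close> of $a_{s\cdot 1}$.\<close>

definition tensor_comp ::
    "'s set \<Rightarrow> ('s \<Rightarrow> nat \<Rightarrow> 'f::field) \<Rightarrow> ('s \<Rightarrow> nat \<Rightarrow> 'f) \<Rightarrow> nat \<Rightarrow> nat \<Rightarrow> 'f" where
  "tensor_comp S \<alpha> \<beta> i j = (\<Sum>s\<in>S. \<alpha> s i * \<beta> s j)"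

text \<open>$\|a_i^j\|$, with row index $i$ and column index $j$, from \<open>t k r\<close> $= a^{kr}$.\<close>

definition equation_matrix ::
    "nat \<Rightarrow> (nat \<Rightarrow> nat \<Rightarrow> nat \<Rightarrow> 'f::field) \<Rightarrow> (nat \<Rightarrow> nat \<Rightarrow> 'f) \<Rightarrow> 'f mat" where
  "equation_matrix n C t =
     mat n n (\<lambda>(i, j). \<Sum>k<n. \<Sum>r<n. \<Sum>p<n. t k r * C k i p * C p r j)"

end

theory Submission imports Defs begin

text \<open>The map $x \mapsto \sum_s a_{s\cdot 0}\,x\,a_{s\cdot 1}$ is linear and sends $\overline{e}_i$ to
  $\sum_j a_i^j\,\overline{e}_j$. Hence its range is the span of these vectors, and its matrix acting
  on coordinate columns is the transpose of $\|a_i^j\|$. A nonzero determinant makes the map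
  injective, hence bijective by finite dimension; a zero determinant gives a nonzero kernel vector,
  whose multiples can be added to any solution.\<close>

context assoc_algebra
begin

text \<open>Independence speaks of the set of basis vectors; injectivity of \<open>e\<close> makes
  it usable for coefficients attached to indices.\<close>

lemma basis_sum_eq_0D:
  assumes "is_basis n e" and "(\<Sum>i<n. v i *s e i) = 0" and "i < n"
  shows "v i = 0"
proof -
  have inj: "inj_on e {..<n}" and ind: "independent (e ` {..<n})"
    using assms(1) by (auto simp: is_basis_def)
  \<comment> \<open>Moves the coefficients from indices to vectors, as the set form of independence
    expects.\<close>
  define u where "u = v \<circ> the_inv_into {..<n} e"
  have u: "u (e j) = v j" if "j < n" for j
    using the_inv_into_f_f[OF inj] that by (simp add: u_def)
  have "(\<Sum>y\<in>e ` {..<n}. u y *s y) = (\<Sum>i<n. v i *s e i)"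
    using u by (simp add: sum.reindex[OF inj])
  then have "u (e i) = 0"
    using independentD[OF ind, of "e ` {..<n}" u "e i"] assms(2,3) by auto
  then show ?thesis using u assms(3) by simp
qed

lemma basis_coordinates_exist:
  assumes "is_basis n e"
  obtains v where "coordinates n e x v"
proof -
  have inj: "inj_on e {..<n}" and "x \<in> span (e ` {..<n})"
    using assms by (auto simp: is_basis_def)
  then obtain u where "x = (\<Sum>y\<in>e ` {..<n}. u y *s y)"
    by (auto simp: span_finite)
  then have "coordinates n e x (\<lambda>i. u (e i))"
    by (simp add: coordinates_def sum.reindex[OF inj])
  then show ?thesis by (rule that)
qed

lemma linear_sandwich_sum: "Vector_Spaces.linear scale scale (\<lambda>x. \<Sum>s\<in>S. a0 s * x * a1 s)"
  by unfold_locales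
    (simp_all add: algebra_simps sum.distrib scale_mult_left scale_mult_right scale_sum_right)

text \<open>Bilinearity reduces the product to the triple products \<open>e k * e i * e r\<close>;
  the rest reorders finite sums until \<open>j\<close> is outermost.\<close>

lemma sandwich_basis:
  assumes "structural_constants n e C" and "coordinates n e a \<alpha>" and "coordinates n e b \<beta>"
    and "i < n"
  shows "a * e i * b = (\<Sum>j<n. (\<Sum>k<n. \<Sum>r<n. \<Sum>p<n. \<alpha> k * \<beta> r * C k i p * C p r j) *s e j)"
proof -
  have C: "e i * e j = (\<Sum>k<n. C i j k *s e k)" if "i < n" "j < n" for i j
    using assms(1) that by (simp add: structural_constants_def)
  \<comment> \<open>The left product is expanded first: \<open>e k * e i\<close> contributes
    \<open>C k i p\<close>, then \<open>e p * e r\<close> contributes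
    \<open>C p r j\<close>.\<close>
  have triple: "e k * e i * e r = (\<Sum>j<n. (\<Sum>p<n. C k i p * C p r j) *s e j)"
    if "k < n" "r < n" for k r
  proof -
    have "e k * e i * e r = (\<Sum>p<n. \<Sum>j<n. (C k i p * C p r j) *s e j)"
      using C assms(4) that by (simp add: sum_distrib_right scale_mult_left scale_sum_right)
    also have "\<dots> = (\<Sum>j<n. \<Sum>p<n. (C k i p * C p r j) *s e j)"
      by (rule sum.swap)
    finally show ?thesis by (simp add: scale_sum_left)
  qed
  have "a * e i * b = (\<Sum>k<n. \<alpha> k *s (e k * e i)) * (\<Sum>r<n. \<beta> r *s e r)"
    using assms(2,3) by (simp add: coordinates_def sum_distrib_right scale_mult_left)
  also have "\<dots> = (\<Sum>k<n. \<Sum>r<n. (\<alpha> k * \<beta> r) *s (e k * e i * e r))"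
    by (simp add: sum_product scale_mult_left scale_mult_right mult.commute[of "\<alpha> _"])
  also have "\<dots> = (\<Sum>k<n. \<Sum>r<n. \<Sum>j<n. (\<Sum>p<n. \<alpha> k * \<beta> r * C k i p * C p r j) *s e j)"
    by (simp add: triple scale_sum_right sum_distrib_left mult.assoc[where 'a = 'f])
  also have "\<dots> = (\<Sum>k<n. \<Sum>j<n. \<Sum>r<n. (\<Sum>p<n. \<alpha> k * \<beta> r * C k i p * C p r j) *s e j)"
    by (intro sum.cong refl sum.swap)
  also have "\<dots> = (\<Sum>j<n. \<Sum>k<n. \<Sum>r<n. (\<Sum>p<n. \<alpha> k * \<beta> r * C k i p * C p r j) *s e j)"
    by (rule sum.swap)
  finally show ?thesis by (simp add: scale_sum_left)
qed

text \<open>Once the sum over \<open>S\<close> is innermost, it only meets the coordinate products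
  and collapses them to the components $a^{kr}$.\<close>

lemma sandwich_sum_basis:
  assumes "structural_constants n e C"
    and "\<And>s. s \<in> S \<Longrightarrow> coordinates n e (a0 s) (\<alpha> s)"
    and "\<And>s. s \<in> S \<Longrightarrow> coordinates n e (a1 s) (\<beta> s)"
    and "i < n"
  shows "(\<Sum>s\<in>S. a0 s * e i * a1 s) =
    (\<Sum>j<n. (equation_matrix n C (tensor_comp S \<alpha> \<beta>) $$ (i, j)) *s e j)"
proof -
  let ?c = "\<lambda>s j k r p. \<alpha> s k * \<beta> s r * C k i p * C p r j"
  have "(\<Sum>s\<in>S. a0 s * e i * a1 s) =
      (\<Sum>s\<in>S. \<Sum>j<n. (\<Sum>k<n. \<Sum>r<n. \<Sum>p<n. ?c s j k r p) *s e j)"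
    using assms by (intro sum.cong refl sandwich_basis)
  also have "\<dots> = (\<Sum>j<n. \<Sum>s\<in>S. (\<Sum>k<n. \<Sum>r<n. \<Sum>p<n. ?c s j k r p) *s e j)"
    by (rule sum.swap)
  also have "\<dots> = (\<Sum>j<n. (\<Sum>s\<in>S. \<Sum>k<n. \<Sum>r<n. \<Sum>p<n. ?c s j k r p) *s e j)"
    by (simp add: scale_sum_left)
  also have "\<dots> = (\<Sum>j<n. (\<Sum>k<n. \<Sum>r<n. \<Sum>p<n. \<Sum>s\<in>S. ?c s j k r p) *s e j)"
    \<comment> \<open>Fixing both index sets makes the swap one-directional: the sum over
      \<open>S\<close> can only move inward, so rewriting terminates.\<close>
    by (simp only: sum.swap[where A = S and B = "{..<n}"])
  also have "\<dots> = (\<Sum>j<n. (equation_matrix n C (tensor_comp S \<alpha> \<beta>) $$ (i, j)) *s e j)"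
    using assms(4) by (simp add: equation_matrix_def tensor_comp_def sum_distrib_right)
  finally show ?thesis .
qed

text \<open>Row \<open>i\<close> of \<open>M\<close> lists the coordinates of
  \<open>f (e i)\<close>, so \<open>f\<close> acts on coordinate columns by the transpose, which has
  the same determinant. Kernel vectors of that matrix and of \<open>f\<close> correspond through the
  basis.\<close>

lemma linear_det_eq_0_iff:
  assumes "is_basis n e" and "Vector_Spaces.linear scale scale f" and M: "M \<in> carrier_mat n n"
    and fe: "\<And>i. i < n \<Longrightarrow> f (e i) = (\<Sum>j<n. (M $$ (i, j)) *s e j)"
  shows "det M = 0 \<longleftrightarrow> (\<exists>x. x \<noteq> 0 \<and> f x = 0)"
proof -
  interpret f: Vector_Spaces.linear scale scale f by fact
  have f_sum: "f (\<Sum>i<n. v $ i *s e i) = (\<Sum>j<n. (transpose_mat M *\<^sub>v v) $ j *s e j)"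
    if "v \<in> carrier_vec n" for v
  proof -
    have "f (\<Sum>i<n. v $ i *s e i) = (\<Sum>i<n. \<Sum>j<n. (v $ i * M $$ (i, j)) *s e j)"
      by (simp add: f.sum f.scale fe scale_sum_right)
    also have "\<dots> = (\<Sum>j<n. \<Sum>i<n. (v $ i * M $$ (i, j)) *s e j)"
      by (rule sum.swap)
    also have "\<dots> = (\<Sum>j<n. (transpose_mat M *\<^sub>v v) $ j *s e j)"
      using that M by (simp add: scale_sum_left scalar_prod_def mult.commute lessThan_atLeast0)
    finally show ?thesis .
  qed
  \<comment> \<open>Needed for \<open>v\<close> and for its image under the transpose, to match zero
    columns with zero elements of the algebra.\<close>
  have zero_iff: "(\<Sum>i<n. v $ i *s e i) = 0 \<longleftrightarrow> v = 0\<^sub>v n" if "v \<in> carrier_vec n" for v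
    using basis_sum_eq_0D[OF assms(1), of "\<lambda>i. v $ i"] that by auto
  have "det M = 0 \<longleftrightarrow> (\<exists>v. v \<in> carrier_vec n \<and> v \<noteq> 0\<^sub>v n \<and> transpose_mat M *\<^sub>v v = 0\<^sub>v n)"
    using det_0_iff_vec_prod_zero_field[of "transpose_mat M" n] M by (simp add: det_transpose[OF M])
  also have "\<dots> \<longleftrightarrow> (\<exists>v. v \<in> carrier_vec n \<and> (\<Sum>i<n. v $ i *s e i) \<noteq> 0 \<and> f (\<Sum>i<n. v $ i *s e i) = 0)"
  proof (intro ex_cong1 conj_cong refl)
    fix v :: "'f vec"
    assume v: "v \<in> carrier_vec n"
    show "v \<noteq> 0\<^sub>v n \<longleftrightarrow> (\<Sum>i<n. v $ i *s e i) \<noteq> 0"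
      using zero_iff[OF v] by simp
    have "transpose_mat M *\<^sub>v v \<in> carrier_vec n"
      using M v by (intro mult_mat_vec_carrier[of _ n n]) simp_all
    then show "transpose_mat M *\<^sub>v v = 0\<^sub>v n \<longleftrightarrow> f (\<Sum>i<n. v $ i *s e i) = 0"
      unfolding f_sum[OF v] by (rule zero_iff[symmetric])
  qed
  also have "\<dots> \<longleftrightarrow> (\<exists>x. x \<noteq> 0 \<and> f x = 0)"
  proof -
    \<comment> \<open>Every element has a coordinate column, so the quantifier over columns becomes
      one over the algebra.\<close>
    have "\<exists>v. v \<in> carrier_vec n \<and> x = (\<Sum>i<n. v $ i *s e i)" for x
    proof -
      obtain c where "coordinates n e x c" by (rule basis_coordinates_exist[OF assms(1)])
      then show ?thesis by (intro exI[of _ "vec n c"]) (simp add: coordinates_def)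
    qed
    then show ?thesis by metis
  qed
  finally show ?thesis .
qed

text \<open>The image of \<open>e\<close> is a finite basis, so an injective endomorphism is
  surjective by dimension.\<close>

lemma linear_inj_imp_bij:
  assumes "is_basis n e" and "Vector_Spaces.linear scale scale f" and "inj f"
  shows "bij f"
proof -
  interpret finite_dimensional_vector_space scale "e ` {..<n}"
    using assms(1) by unfold_locales (auto simp: is_basis_def)
  show ?thesis
    using linear_inj_imp_surj[OF assms(2,3)] assms(3) by (simp add: bij_def)
qed

text \<open>The line through \<open>x\<close> in direction \<open>u\<close> consists of solutions,
  and distinct scalars give distinct points on it because \<open>u\<close> is nonzero.\<close>

lemma infinite_solutions_of_kernel:
  assumes "Vector_Spaces.linear scale scale f" and "infinite (UNIV :: 'f set)"
    and "u \<noteq> 0" and "f u = 0" and "f x = b"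
  shows "infinite {x. f x = b}"
proof -
  interpret f: Vector_Spaces.linear scale scale f by fact
  have "inj (\<lambda>c. x + c *s u)"
    using assms(3) by (auto intro: injI)
  moreover have "range (\<lambda>c. x + c *s u) \<subseteq> {x. f x = b}"
    using assms(4,5) by (auto simp: f.add f.scale)
  ultimately show ?thesis
    using assms(2) finite_imageD finite_subset by blast
qed

end

text \<open>Infinitude of the solution set is asserted over infinite fields: over a finite field the
  algebra itself is finite.\<close>

theorem theorem4p1:
  fixes scale :: "'f::field \<Rightarrow> 'a::ring \<Rightarrow> 'a"
    and e :: "nat \<Rightarrow> 'a" and n :: nat
    and C :: "nat \<Rightarrow> nat \<Rightarrow> nat \<Rightarrow> 'f"
    and S :: "'s set" and a0 a1 :: "'s \<Rightarrow> 'a"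
    and \<alpha> \<beta> :: "'s \<Rightarrow> nat \<Rightarrow> 'f"
    and b :: 'a and M :: "'f mat" and Sol :: "'a set" and R :: "'a set"
  assumes "assoc_algebra scale"
    and "assoc_algebra.is_basis scale n e"
    and "assoc_algebra.structural_constants scale n e C"
    and "finite S"
    and "\<And>s. s \<in> S \<Longrightarrow> assoc_algebra.coordinates scale n e (a0 s) (\<alpha> s)"
    and "\<And>s. s \<in> S \<Longrightarrow> assoc_algebra.coordinates scale n e (a1 s) (\<beta> s)"
    and "M = equation_matrix n C (tensor_comp S \<alpha> \<beta>)"
    and "Sol = {x. (\<Sum>s\<in>S. a0 s * x * a1 s) = b}"
    and "R = {\<Sum>j<n. scale (M $$ (i, j)) (e j) | i. i < n}"
  shows "(det M \<noteq> 0 \<longrightarrow> (\<exists>!x. x \<in> Sol)) \<and>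
         (det M = 0 \<longrightarrow>
            ((\<exists>x. x \<in> Sol) \<longleftrightarrow> b \<in> Modules.module.span scale R) \<and>
            (b \<in> Modules.module.span scale R \<longrightarrow> infinite (UNIV :: 'f set) \<longrightarrow> infinite Sol) \<and>
            (b \<notin> Modules.module.span scale R \<longrightarrow> Sol = {}))"
proof -
  interpret assoc_algebra scale by fact
  define f where "f x = (\<Sum>s\<in>S. a0 s * x * a1 s)" for x
  have lin: "Vector_Spaces.linear scale scale f"
    unfolding f_def by (rule linear_sandwich_sum)
  interpret f: Vector_Spaces.linear scale scale f by (rule lin)
  have fe: "f (e i) = (\<Sum>j<n. scale (M $$ (i, j)) (e j))" if "i < n" for i
    unfolding f_def assms(7) using that by (intro sandwich_sum_basis assms)
  have M: "M \<in> carrier_mat n n"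
    by (simp add: assms(7) equation_matrix_def)
  note det_iff = linear_det_eq_0_iff[OF assms(2) lin M fe]
  have "R = f ` e ` {..<n}"
    unfolding assms(9) using fe by force
  \<comment> \<open>A linear map sends the span of the basis, which is the whole algebra, onto the
    span of the images.\<close>
  then have "span R = range f"
    using assms(2) by (simp add: f.span_image is_basis_def)
  moreover have Sol: "Sol = {x. f x = b}"
    by (simp add: assms(8) f_def)
  ultimately have solvable: "(\<exists>x. x \<in> Sol) \<longleftrightarrow> b \<in> span R"
    by auto
  have "\<exists>!x. x \<in> Sol" if "det M \<noteq> 0"
  proof -
    have "inj f"
      using det_iff that by (auto simp: f.inj_iff_eq_0)
    then have "bij f"
      by (rule linear_inj_imp_bij[OF assms(2) lin])
    then show ?thesis
      unfolding Sol by (simp add: bij_iff)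
  qed
  moreover have "infinite Sol"
    if "det M = 0" and "b \<in> span R" and "infinite (UNIV :: 'f set)"
  proof -
    obtain u where "u \<noteq> 0" "f u = 0"
      using det_iff \<open>det M = 0\<close> by blast
    moreover obtain x where "f x = b"
      using solvable \<open>b \<in> span R\<close> by (auto simp: Sol)
    ultimately show ?thesis
      unfolding Sol using infinite_solutions_of_kernel[OF lin] that(3) by blast
  qed
  ultimately show ?thesis
    using solvable by blast
qed

end
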